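(* Let $T$ be a $k$-tree and $C$ a $k$-clique of $T$. Then $\mu(T;C)<2\mu(T)$.
   Context: A $k$-tree is defined recursively: $K_k$ is a $k$-tree, and if $T$ is a $k$-tree then so is the graph obtained by joining a new vertex to all vertices of some $k$-clique of $T$; there are no others. A sub-$k$-tree of $T$ is a subgraph that is itself a $k$-tree. $\mu(T)$ is the average number of vertices over all sub-$k$-trees of $T$; $\mu(T;C)$ is the average number of vertices over all sub-$k$-trees of $T$ that contain $C$. *)

theory Defs
  imports Complex_Main
begin

text \<open>Graphs are pairs (V, E) with E a set of 2-element subsets of V.\<close>

definition is_clique :: "'a set set \<Rightarrow> 'a set \<Rightarrow> bool" where
  "is_clique E C \<longleftrightarrow> (\<forall>x\<in>C. \<forall>y\<in>C. x \<noteq> y \<longrightarrow> {x, y} \<in> E)"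

definition k_clique :: "nat \<Rightarrow> 'a set \<Rightarrow> 'a set set \<Rightarrow> 'a set \<Rightarrow> bool" where
  "k_clique k V E C \<longleftrightarrow> C \<subseteq> V \<and> finite C \<and> card C = k \<and> is_clique E C"

definition complete_edges :: "'a set \<Rightarrow> 'a set set" where
  "complete_edges V = {e. e \<subseteq> V \<and> card e = 2}"

inductive ktree :: "nat \<Rightarrow> 'a set \<Rightarrow> 'a set set \<Rightarrow> bool" for k :: nat where
  base: "finite V \<Longrightarrow> card V = k \<Longrightarrow> ktree k V (complete_edges V)"
| step: "ktree k V E \<Longrightarrow> v \<notin> V \<Longrightarrow> k_clique k V E C \<Longrightarrow>
         ktree k (insert v V) (E \<union> {{v, c} | c. c \<in> C})"

definition sub_ktrees :: "nat \<Rightarrow> 'a set \<Rightarrow> 'a set set \<Rightarrow> ('a set \<times> 'a set set) set" where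
  "sub_ktrees k V E = {(V', E'). V' \<subseteq> V \<and> E' \<subseteq> E \<and> ktree k V' E'}"

definition sub_ktrees_at :: "nat \<Rightarrow> 'a set \<Rightarrow> 'a set set \<Rightarrow> 'a set \<Rightarrow> ('a set \<times> 'a set set) set" where
  "sub_ktrees_at k V E C =
     {(V', E') \<in> sub_ktrees k V E. C \<subseteq> V' \<and> complete_edges C \<subseteq> E'}"

definition avg_order :: "('a set \<times> 'a set set) set \<Rightarrow> real" where
  "avg_order S = (\<Sum>(V', E')\<in>S. real (card V')) / real (card S)"

definition mu :: "nat \<Rightarrow> 'a set \<Rightarrow> 'a set set \<Rightarrow> real" where
  "mu k V E = avg_order (sub_ktrees k V E)"

definition mu_at :: "nat \<Rightarrow> 'a set \<Rightarrow> 'a set set \<Rightarrow> 'a set \<Rightarrow> real" where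
  "mu_at k V E C = avg_order (sub_ktrees_at k V E C)"

end

theory Submission
  imports Defs
begin

text \<open>
  A k-tree can be grown from any of its k-cliques, so take C as the root. Let v be the vertex added
  last, joined to the clique X. A sub-k-tree using v is either one of the k new cliques or a
  sub-k-tree containing X with v added. Hence v can be deleted, at the price of recording at X how
  many sub-k-trees, and of what mean order, hang below it. Four numbers per clique suffice, and
  deleting v preserves a system of inequalities between them that, once only C is left, contains
  the claim.
\<close>

section \<open>Structure of k-trees\<close>

text \<open>Contraction changes none of the sums in the claim, so the difficulty is numerical: the
  numbers at \<open>X\<close> must satisfy \<open>weight_inv\<close> again after absorbing
  \<open>v\<close>. The obstacle is that the mean at \<open>X\<close> becomes
  \<open>k + m + x\<close>, while the branch below a new clique only controls
  \<open>2 * r i - (k + m i) * n i\<close>; thus \<open>(m + x - m i) * n i\<close> is lost in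
  branch \<open>i\<close>. Hence \<open>m\<close> and \<open>n\<close> must be bounded in terms of
  \<open>N\<close>, and the last conjunct carries a gain of \<open>k\<close> rather than mere
  positivity: the \<open>k\<close> new branches jointly bring \<open>k\<^sup>2\<close>, which pays
  for part of the loss, while the \<open>k\<close> already present at \<open>X\<close> is handed on.
  The gap between \<open>N = 1\<close> and \<open>N \<ge> 2\<close> separates one nontrivial branch
  from several. On the combinatorial side, a sub-k-tree has a construction of its own, in which
  \<open>v\<close> need not come last. The degree of \<open>v\<close> decides whether it can be
  moved to the end.\<close>

definition star :: "'a \<Rightarrow> 'a set \<Rightarrow> 'a set set" where
  "star v X = {{v, c} | c. c \<in> X}"

lemma complete_edges_doubleton [simp]:
  "{x, y} \<in> complete_edges V \<longleftrightarrow> x \<in> V \<and> y \<in> V \<and> x \<noteq> y"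
  by (auto simp: complete_edges_def card_insert_if)

lemma complete_edgesE:
  assumes "e \<in> complete_edges V"
  obtains x y where "e = {x, y}" "x \<in> V" "y \<in> V" "x \<noteq> y"
  using assms by (auto simp: complete_edges_def card_2_iff)

lemma complete_edges_mono: "U \<subseteq> V \<Longrightarrow> complete_edges U \<subseteq> complete_edges V"
  by (auto simp: complete_edges_def)

lemma doubleton_in_star: "{x, y} \<in> star v X \<longleftrightarrow> x = v \<and> y \<in> X \<or> y = v \<and> x \<in> X"
  by (auto simp: star_def doubleton_eq_iff)

lemma complete_edges_insert:
  assumes "v \<notin> W"
  shows "complete_edges (insert v W) = complete_edges W \<union> star v W"
proof (intro set_eqI iffI)
  fix e assume "e \<in> complete_edges (insert v W)"
  then show "e \<in> complete_edges W \<union> star v W"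
    by (elim complete_edgesE) (auto simp: doubleton_in_star)
next
  fix e assume "e \<in> complete_edges W \<union> star v W"
  then show "e \<in> complete_edges (insert v W)"
    using assms by (auto simp: star_def complete_edges_mono elim!: complete_edgesE)
qed

lemma complete_edges_subset_iff: "complete_edges C \<subseteq> E \<longleftrightarrow> is_clique E C"
  unfolding is_clique_def by (auto elim!: complete_edgesE)

lemma k_clique_altdef:
  "k_clique k V E C \<longleftrightarrow> C \<subseteq> V \<and> finite C \<and> card C = k \<and> complete_edges C \<subseteq> E"
  by (simp add: k_clique_def complete_edges_subset_iff)

lemma ktree_step:
  "ktree k V E \<Longrightarrow> v \<notin> V \<Longrightarrow> k_clique k V E X \<Longrightarrow> ktree k (insert v V) (E \<union> star v X)"
  unfolding star_def by (rule ktree.step)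

lemma ktree_induct [consumes 1, case_names base step]:
  assumes "ktree k V E"
    and "\<And>V. finite V \<Longrightarrow> card V = k \<Longrightarrow> P V (complete_edges V)"
    and "\<And>V E v X. ktree k V E \<Longrightarrow> P V E \<Longrightarrow> v \<notin> V \<Longrightarrow> k_clique k V E X \<Longrightarrow>
      P (insert v V) (E \<union> star v X)"
  shows "P V E"
  using assms by (induction rule: ktree.induct) (auto simp: star_def)

lemma ktree_wf:
  assumes "ktree k V E"
  shows "finite V" "k \<le> card V" "E \<subseteq> complete_edges V"
proof -
  have "finite V \<and> k \<le> card V \<and> E \<subseteq> complete_edges V"
    using assms
  proof (induction rule: ktree_induct)
    case (step V E v X)
    have "E \<subseteq> complete_edges (insert v V)"
      using step complete_edges_mono[of V "insert v V"] by blast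
    moreover have "star v X \<subseteq> complete_edges (insert v V)"
      using step by (auto simp: star_def k_clique_def)
    ultimately show ?case
      using step by simp
  qed auto
  then show "finite V" "k \<le> card V" "E \<subseteq> complete_edges V"
    by auto
qed

lemma ktree_card_eq:
  assumes "ktree k V E" "card V = k"
  shows "E = complete_edges V"
  using assms
proof (cases rule: ktree.cases)
  case (step V' E' v X)
  then show ?thesis
    using ktree_wf[OF step(3)] assms(2) by simp
qed

lemma ktree_edgeD:
  "ktree k V E \<Longrightarrow> {x, y} \<in> E \<Longrightarrow> x \<in> V \<and> y \<in> V \<and> x \<noteq> y"
  using ktree_wf(3)[of k V E] complete_edges_doubleton[of x y V] by blast

section \<open>Degrees and the choice of a last vertex\<close>

definition nbrs :: "'a set set \<Rightarrow> 'a \<Rightarrow> 'a set" where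
  "nbrs E v = {u. {v, u} \<in> E}"

lemma finite_nbrs: "ktree k V E \<Longrightarrow> finite (nbrs E v)"
  by (rule finite_subset[of _ V]) (auto simp: nbrs_def ktree_wf dest: ktree_edgeD)

text \<open>The minimum accounts for the initial clique, whose degrees are only
  \<open>k - 1\<close>.\<close>

lemma ktree_min_degree:
  assumes "ktree k V E" "v \<in> V"
  shows "min k (card V - 1) \<le> card (nbrs E v)"
  using assms
proof (induction rule: ktree_induct)
  case (base V)
  then have "nbrs (complete_edges V) v = V - {v}"
    by (auto simp: nbrs_def)
  then show ?case
    using base by simp
next
  case (step V E u X)
  have T: "ktree k (insert u V) (E \<union> star u X)"
    using step by (intro ktree_step)
  show ?case
  proof (cases "v = u")
    case True
    then have "X \<subseteq> nbrs (E \<union> star u X) v"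
      by (auto simp: nbrs_def doubleton_in_star)
    then have "card X \<le> card (nbrs (E \<union> star u X) v)"
      using finite_nbrs[OF T] by (intro card_mono)
    then show ?thesis
      using step by (simp add: k_clique_def)
  next
    case v: False
    have sub: "nbrs E v \<subseteq> nbrs (E \<union> star u X) v"
      by (auto simp: nbrs_def)
    show ?thesis
    \<comment> \<open>Only here does the bound rise: \<open>X\<close> is all of \<open>V\<close>, so
      every old vertex gains \<open>u\<close> as its k-th neighbour.\<close>
    proof (cases "card V = k")
      case True
      then have "X = V"
        using step ktree_wf[OF step(1)] by (intro card_subset_eq) (auto simp: k_clique_def)
      then have "insert u (nbrs E v) \<subseteq> nbrs (E \<union> star u X) v"
        using sub v step by (auto simp: nbrs_def doubleton_in_star)
      then have "card (insert u (nbrs E v)) \<le> card (nbrs (E \<union> star u X) v)"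
        using finite_nbrs[OF T] by (intro card_mono)
      moreover have "u \<notin> nbrs E v"
        using step ktree_edgeD[OF step(1)] by (auto simp: nbrs_def)
      ultimately show ?thesis
        using step True v ktree_wf[OF step(1)] finite_nbrs[OF step(1), of v] by simp
    next
      case False
      then have "k \<le> card (nbrs E v)"
        using step v ktree_wf[OF step(1)] by auto
      also have "\<dots> \<le> card (nbrs (E \<union> star u X) v)"
        using sub finite_nbrs[OF T] by (intro card_mono)
      finally show ?thesis
        by simp
    qed
  qed
qed

text \<open>The addition of \<open>v\<close> commutes with that of any later vertex
  \<open>u\<close>: were \<open>v\<close> in the clique of \<open>u\<close>, its degree would exceed
  \<open>k\<close>. The exception is the complete graph on \<open>k + 1\<close> vertices, where any
  vertex may be last by symmetry.\<close>

lemma ktree_delete: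
  assumes "ktree k V E" "k < card V" "v \<in> V" "card (nbrs E v) \<le> k"
  shows "\<exists>E0 K. ktree k (V - {v}) E0 \<and> k_clique k (V - {v}) E0 K \<and> E = E0 \<union> star v K"
  using assms
proof (induction rule: ktree_induct)
  case (step V E u X)
  have T: "ktree k (insert u V) (E \<union> star u X)"
    using step by (intro ktree_step)
  show ?case
  proof (cases "v = u")
    case True
    then have "insert u V - {v} = V"
      using step by auto
    then show ?thesis
      using step True by auto
  next
    case v: False
    then have vV: "v \<in> V"
      using step by auto
    show ?thesis
    proof (cases "card V = k")
      case True
      have XV: "X = V"
        using step True ktree_wf[OF step(1)] by (intro card_subset_eq) (auto simp: k_clique_def)
      define W where "W = insert u V - {v}"
      have W: "finite W" "card W = k" "insert v W = insert u V" "v \<notin> W"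
        using vV v step True ktree_wf[OF step(1)] by (auto simp: W_def)
      have "E \<union> star u X = complete_edges (insert u V)"
        using ktree_card_eq[OF step(1) True] XV step by (simp add: complete_edges_insert)
      also have "\<dots> = complete_edges W \<union> star v W"
        using W complete_edges_insert[of v W] by simp
      finally have "E \<union> star u X = complete_edges W \<union> star v W" .
      moreover have "ktree k W (complete_edges W)" "k_clique k W (complete_edges W) W"
        using W by (auto intro: ktree.base simp: k_clique_altdef)
      ultimately show ?thesis
        unfolding W_def by blast
    next
      case False
      then have kV: "k < card V"
        using ktree_wf[OF step(1)] by simp
      have sub: "nbrs E v \<subseteq> nbrs (E \<union> star u X) v"
        by (auto simp: nbrs_def)
      then have deg: "card (nbrs E v) \<le> k"
        using card_mono[OF finite_nbrs[OF T] sub] step by simp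
      obtain E0 K where IH: "ktree k (V - {v}) E0" "k_clique k (V - {v}) E0 K" "E = E0 \<union> star v K"
        using step.IH[OF kV vV deg] by blast
      have "v \<notin> X"
      proof
        assume "v \<in> X"
        then have "insert u (nbrs E v) \<subseteq> nbrs (E \<union> star u X) v"
          using sub by (auto simp: nbrs_def doubleton_in_star)
        then have "card (insert u (nbrs E v)) \<le> card (nbrs (E \<union> star u X) v)"
          using finite_nbrs[OF T] by (intro card_mono)
        moreover have "u \<notin> nbrs E v"
          using step ktree_edgeD[OF step(1)] by (auto simp: nbrs_def)
        moreover have "k \<le> card (nbrs E v)"
          using ktree_min_degree[OF step(1) vV] kV by simp
        ultimately show False
          using step finite_nbrs[OF step(1), of v] by simp
      qed
      then have "k_clique k (V - {v}) E0 X"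
        using step IH(3) by (auto simp: k_clique_def is_clique_def doubleton_in_star)
      then have "ktree k (insert u (V - {v})) (E0 \<union> star u X)"
        using IH step by (intro ktree_step) auto
      moreover have "insert u (V - {v}) = insert u V - {v}"
        using v by auto
      moreover have "k_clique k (insert u (V - {v})) (E0 \<union> star u X) K"
        using IH by (auto simp: k_clique_def is_clique_def)
      moreover have "E \<union> star u X = (E0 \<union> star u X) \<union> star v K"
        using IH by auto
      ultimately show ?thesis
        by metis
    qed
  qed
qed auto

section \<open>Cliques and sub-k-trees after adding a vertex\<close>

definition cliques :: "nat \<Rightarrow> 'a set \<times> 'a set set \<Rightarrow> 'a set set" where
  "cliques k S = {Y. k_clique k (fst S) (snd S) Y}"

definition cone :: "'a \<Rightarrow> 'a set \<Rightarrow> 'a set \<times> 'a set set \<Rightarrow> 'a set \<times> 'a set set" where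
  "cone v X S = (insert v (fst S), snd S \<union> star v X)"

definition full :: "'a set \<Rightarrow> 'a set \<times> 'a set set" where
  "full Y = (Y, complete_edges Y)"

definition swap :: "'a \<Rightarrow> 'a set \<Rightarrow> 'a \<Rightarrow> 'a set" where
  "swap v X x = insert v (X - {x})"

lemma inj_on_swap: "v \<notin> X \<Longrightarrow> inj_on (swap v X) X"
  by (auto simp: inj_on_def swap_def)

lemma cliques_full: "finite Y \<Longrightarrow> card Y = k \<Longrightarrow> cliques k (full Y) = {Y}"
  by (auto simp: cliques_def full_def k_clique_altdef dest: card_subset_eq)

lemma finite_cliques: "ktree k V E \<Longrightarrow> finite (cliques k (V, E))"
  by (rule finite_subset[of _ "Pow V"]) (auto simp: cliques_def k_clique_def ktree_wf)

text \<open>All neighbours of \<open>v\<close> lie in \<open>X\<close>, so by size a k-clique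
  through \<open>v\<close> misses exactly one vertex of \<open>X\<close>.\<close>

lemma cliques_cone:
  assumes "ktree k V E" "v \<notin> V" "X \<in> cliques k (V, E)" "1 \<le> k"
  shows "cliques k (cone v X (V, E)) = cliques k (V, E) \<union> swap v X ` X"
    and "cliques k (V, E) \<inter> swap v X ` X = {}"
proof -
  have X: "X \<subseteq> V" "finite X" "card X = k" "is_clique E X"
    using assms by (auto simp: cliques_def k_clique_def)
  have edge: "{v, y} \<notin> E" "{y, v} \<notin> E" for y
    using ktree_edgeD[OF assms(1)] assms(2) by auto
  show "cliques k (V, E) \<inter> swap v X ` X = {}"
    using assms(2) by (auto simp: cliques_def k_clique_def swap_def)
  show "cliques k (cone v X (V, E)) = cliques k (V, E) \<union> swap v X ` X"
  proof (intro set_eqI iffI)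
    fix Y assume Y: "Y \<in> cliques k (cone v X (V, E))"
    then have Y': "Y \<subseteq> insert v V" "finite Y" "card Y = k" "is_clique (E \<union> star v X) Y"
      by (auto simp: cliques_def k_clique_def cone_def)
    show "Y \<in> cliques k (V, E) \<union> swap v X ` X"
    proof (cases "v \<in> Y")
      case False
      then have "{x, y} \<in> E" if "x \<in> Y" "y \<in> Y" "x \<noteq> y" for x y
        using that Y'(4) by (auto simp: is_clique_def doubleton_in_star)
      then show ?thesis
        using Y' False by (auto simp: cliques_def k_clique_def is_clique_def)
    next
      case True
      have "y \<in> X" if "y \<in> Y - {v}" for y
        using that True Y'(4) edge unfolding is_clique_def by (metis DiffE UnE doubleton_in_star insertI1)
      then have sub: "Y - {v} \<subseteq> X"
        by blast
      have "card (X - (Y - {v})) = 1"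
        using sub X Y' True assms(4) by (simp add: card_Diff_subset)
      then obtain x where "X - (Y - {v}) = {x}"
        by (auto simp: card_1_singleton_iff)
      then have "x \<in> X" "Y = swap v X x"
        using sub True by (auto simp: swap_def)
      then show ?thesis
        by blast
    qed
  next
    fix Y assume "Y \<in> cliques k (V, E) \<union> swap v X ` X"
    then show "Y \<in> cliques k (cone v X (V, E))"
    proof
      assume "Y \<in> cliques k (V, E)"
      then show ?thesis
        by (auto simp: cliques_def k_clique_def cone_def is_clique_def)
    next
      assume "Y \<in> swap v X ` X"
      then obtain x where x: "x \<in> X" "Y = insert v (X - {x})"
        by (auto simp: swap_def)
      have "v \<notin> X"
        using X assms by auto
      then have "card Y = k"
        using x X assms(4) by simp
      then show ?thesis
        using x X by (auto simp: cliques_def k_clique_def cone_def is_clique_def doubleton_in_star)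
    qed
  qed
qed

lemma sub_ktreesI:
  "ktree k V' E' \<Longrightarrow> V' \<subseteq> V \<Longrightarrow> E' \<subseteq> E \<Longrightarrow> (V', E') \<in> sub_ktrees k V E"
  by (simp add: sub_ktrees_def)

lemma finite_sub_ktrees: "ktree k V E \<Longrightarrow> finite (sub_ktrees k V E)"
proof -
  assume T: "ktree k V E"
  have "E \<subseteq> Pow V"
    using ktree_wf(3)[OF T] by (auto simp: complete_edges_def)
  then have "finite E"
    using ktree_wf(1)[OF T] finite_subset[of E "Pow V"] by simp
  moreover have "sub_ktrees k V E \<subseteq> Pow V \<times> Pow E"
    by (auto simp: sub_ktrees_def)
  ultimately show ?thesis
    using ktree_wf(1)[OF T] finite_subset[of "sub_ktrees k V E" "Pow V \<times> Pow E"] by simp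
qed

lemma full_in_sub_ktrees:
  "Y \<in> cliques k (V, E) \<Longrightarrow> full Y \<in> sub_ktrees k V E"
  by (auto simp: cliques_def k_clique_altdef full_def intro!: sub_ktreesI ktree.base)

lemma sub_ktrees_full:
  assumes "finite C" "card C = k"
  shows "sub_ktrees k C (complete_edges C) = {full C}"
proof (intro set_eqI iffI)
  fix S assume "S \<in> sub_ktrees k C (complete_edges C)"
  then obtain V' E' where S: "S = (V', E')" "V' \<subseteq> C" "ktree k V' E'"
    by (auto simp: sub_ktrees_def)
  then have "V' = C"
    using ktree_wf[OF S(3)] card_mono[of C V'] assms by (intro card_subset_eq) auto
  then show "S \<in> {full C}"
    using ktree_card_eq[OF S(3)] S assms by (simp add: full_def)
next
  fix S assume "S \<in> {full C}"
  then show "S \<in> sub_ktrees k C (complete_edges C)"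
    using assms by (auto simp: full_def intro!: sub_ktreesI ktree.base)
qed

text \<open>In a sub-k-tree with more than \<open>k\<close> vertices, \<open>v\<close> has degree at
  most \<open>k\<close>, so \<open>ktree_delete\<close> makes it the last vertex. It is then joined
  to a k-clique inside \<open>X\<close>, which must be \<open>X\<close> itself.\<close>

lemma sub_ktrees_cone:
  assumes T: "ktree k V E" and v: "v \<notin> V" and X: "X \<in> cliques k (V, E)" and k: "1 \<le> k"
  shows "sub_ktrees k (insert v V) (E \<union> star v X) = sub_ktrees k V E
    \<union> cone v X ` {S \<in> sub_ktrees k V E. X \<in> cliques k S} \<union> full ` swap v X ` X"
    (is "?L = ?A \<union> ?B \<union> ?C")
proof (intro set_eqI iffI)
  have edge: "{v, y} \<notin> E" "{y, v} \<notin> E" for y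
    using ktree_edgeD[OF T] v by auto
  have X': "X \<subseteq> V" "finite X" "card X = k"
    using X by (auto simp: cliques_def k_clique_def)
  fix S assume "S \<in> ?L"
  then obtain V' E' where S: "S = (V', E')" "V' \<subseteq> insert v V" "E' \<subseteq> E \<union> star v X" "ktree k V' E'"
    by (auto simp: sub_ktrees_def)
  show "S \<in> ?A \<union> ?B \<union> ?C"
  proof (cases "v \<in> V'")
    case False
    have "E' \<subseteq> E"
    proof
      fix e assume e: "e \<in> E'"
      then show "e \<in> E"
        using S(3) ktree_edgeD[OF S(4)] False by (auto simp: star_def)
    qed
    then have "S \<in> ?A"
      using S False by (auto intro!: sub_ktreesI)
    then show ?thesis
      by blast
  next
    case vV: True
    show ?thesis
    proof (cases "card V' = k")
      case True
      then have E': "E' = complete_edges V'"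
        using ktree_card_eq S by blast
      then have "V' \<in> cliques k (cone v X (V, E))"
        using S True ktree_wf[OF S(4)] by (auto simp: cliques_def cone_def k_clique_altdef)
      moreover have "V' \<notin> cliques k (V, E)"
        using vV v by (auto simp: cliques_def k_clique_def)
      ultimately have "V' \<in> swap v X ` X"
        using cliques_cone(1)[OF T v X k] by blast
      then show ?thesis
        using S E' by (auto simp: full_def)
    next
      case False
      then have kV: "k < card V'"
        using ktree_wf[OF S(4)] by simp
      have nX: "nbrs E' v \<subseteq> X"
        using S(3) edge v X' by (auto simp: nbrs_def doubleton_in_star)
      then have "card (nbrs E' v) \<le> k"
        using X' card_mono by blast
      then obtain E0 K where K: "ktree k (V' - {v}) E0" "k_clique k (V' - {v}) E0 K" "E' = E0 \<union> star v K"
        using ktree_delete[OF S(4) kV vV] by blast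
      have "K \<subseteq> X"
        using nX K(3) by (auto simp: nbrs_def doubleton_in_star)
      then have KX: "K = X"
        using K X' by (intro card_subset_eq) (auto simp: k_clique_def)
      have "E0 \<subseteq> E"
      proof
        fix e assume "e \<in> E0"
        then have "e \<notin> star v X" "e \<in> E \<union> star v X"
          using S(3) ktree_edgeD[OF K(1)] K(3) by (auto simp: star_def)
        then show "e \<in> E"
          by blast
      qed
      then have "(V' - {v}, E0) \<in> {S \<in> sub_ktrees k V E. X \<in> cliques k S}"
        using K S KX by (auto intro!: sub_ktreesI simp: cliques_def)
      moreover have "S = cone v X (V' - {v}, E0)"
        using S K KX vV by (auto simp: cone_def)
      ultimately show ?thesis
        by blast
    qed
  qed
next
  fix S assume "S \<in> ?A \<union> ?B \<union> ?C"
  then consider "S \<in> ?A" | "S \<in> ?B" | "S \<in> ?C"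
    by blast
  then show "S \<in> ?L"
  proof cases
    case 1
    then show ?thesis
      by (auto simp: sub_ktrees_def)
  next
    case 2
    then show ?thesis
      using v by (force simp: sub_ktrees_def cone_def cliques_def intro!: ktree_step)
  next
    case 3
    then show ?thesis
      using cliques_cone(1)[OF T v X k]
      by (auto simp: cone_def intro!: full_in_sub_ktrees)
  qed
qed

text \<open>The vertex \<open>v\<close> separates the first part of \<open>sub_ktrees_cone\<close>
  from the other two, and the order separates cones (more than \<open>k\<close> vertices) from bare
  cliques (exactly \<open>k\<close>).\<close>

lemma sum_sub_ktrees_cone:
  fixes g :: "'a set \<times> 'a set set \<Rightarrow> real"
  assumes T: "ktree k V E" and v: "v \<notin> V" and X: "X \<in> cliques k (V, E)" and k: "1 \<le> k"
  shows "sum g (sub_ktrees k (insert v V) (E \<union> star v X)) =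
    (\<Sum>S\<in>sub_ktrees k V E. g S + (if X \<in> cliques k S then g (cone v X S) else 0))
    + (\<Sum>x\<in>X. g (full (swap v X x)))"
proof -
  let ?A = "sub_ktrees k V E"
  let ?B0 = "{S \<in> ?A. X \<in> cliques k S}"
  have X': "X \<subseteq> V" "finite X" "card X = k"
    using X by (auto simp: cliques_def k_clique_def)
  have fA: "finite ?A"
    by (rule finite_sub_ktrees[OF T])
  have inA: "v \<notin> fst S" "\<And>c. {v, c} \<notin> snd S" if "S \<in> ?A" for S
    using that v ktree_edgeD[OF T] by (auto simp: sub_ktrees_def)
  have inj: "inj_on (cone v X) ?B0"
  proof (rule inj_onI)
    fix S S' assume S: "S \<in> ?B0" "S' \<in> ?B0" "cone v X S = cone v X S'"
    have "fst S = fst S'"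
      using S inA(1)[of S] inA(1)[of S'] by (auto simp: cone_def)
    moreover have "snd S \<inter> star v X = {}" "snd S' \<inter> star v X = {}"
      using S inA(2)[of S] inA(2)[of S'] by (auto simp: star_def)
    then have "snd S = snd S'"
      using S by (auto simp: cone_def)
    ultimately show "S = S'"
      by (simp add: prod_eq_iff)
  qed
  have inj2: "inj_on (\<lambda>x. full (swap v X x)) X"
    using inj_on_swap[of v X] v X' by (auto simp: inj_on_def full_def)
  have d1: "?A \<inter> cone v X ` ?B0 = {}"
    using inA(1) by (force simp: cone_def)
  have "card (fst S) > k" if *: "S \<in> cone v X ` ?B0" for S
  proof -
    obtain V' E' where S: "S = (insert v V', E' \<union> star v X)" "V' \<subseteq> V" "ktree k V' E'"
      using * by (auto simp: cone_def sub_ktrees_def)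
    then have "v \<notin> V'"
      using v by auto
    then show ?thesis
      using S ktree_wf[OF S(3)] by simp
  qed
  moreover have "card (fst S) = k" if *: "S \<in> full ` swap v X ` X" for S
  proof -
    obtain x where x: "x \<in> X" "fst S = insert v (X - {x})"
      using * by (auto simp: full_def swap_def)
    have "v \<notin> X"
      using X' v by blast
    then show ?thesis
      using x X' k by simp
  qed
  ultimately have d2: "cone v X ` ?B0 \<inter> full ` swap v X ` X = {}"
    by (metis (no_types, lifting) disjoint_iff less_irrefl)
  have d3: "?A \<inter> full ` swap v X ` X = {}"
    using inA(1) by (force simp: full_def swap_def)
  have "sum g (sub_ktrees k (insert v V) (E \<union> star v X))
     = sum g ?A + sum g (cone v X ` ?B0) + sum g (full ` swap v X ` X)"
  proof -
    have "(?A \<union> cone v X ` ?B0) \<inter> full ` swap v X ` X = {}"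
      using d2 d3 by blast
    then show ?thesis
      unfolding sub_ktrees_cone[OF T v X k]
      using d1 fA X'(2) by (simp add: sum.union_disjoint)
  qed
  also have "sum g (cone v X ` ?B0) = (\<Sum>S\<in>?B0. g (cone v X S))"
    using inj by (simp add: sum.reindex)
  also have "\<dots> = (\<Sum>S\<in>?A. if X \<in> cliques k S then g (cone v X S) else 0)"
    using fA by (simp add: sum.inter_filter)
  also have "sum g (full ` swap v X ` X) = (\<Sum>x\<in>X. g (full (swap v X x)))"
    unfolding image_image using inj2 by (simp add: sum.reindex)
  finally show ?thesis
    by (simp add: sum.distrib)
qed

section \<open>Growing a k-tree from a prescribed root clique\<close>

inductive ktree_from :: "nat \<Rightarrow> 'a set \<Rightarrow> 'a set \<Rightarrow> 'a set set \<Rightarrow> bool" for k C where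
  base: "finite C \<Longrightarrow> card C = k \<Longrightarrow> ktree_from k C C (complete_edges C)"
| step: "ktree_from k C V E \<Longrightarrow> v \<notin> V \<Longrightarrow> k_clique k V E X \<Longrightarrow>
    ktree_from k C (insert v V) (E \<union> star v X)"

lemma ktree_from_imp_ktree: "ktree_from k C V E \<Longrightarrow> ktree k V E"
  by (induction rule: ktree_from.induct) (auto intro: ktree.base ktree_step)

lemma ktree_from_root: "ktree_from k C V E \<Longrightarrow> C \<subseteq> V"
  by (induction rule: ktree_from.induct) auto

text \<open>Start with the swapped clique and add \<open>x\<close> back: this gives the same
  complete graph on \<open>k + 1\<close> vertices as joining \<open>v\<close> to \<open>X\<close>,
  and all later vertices are added as before.\<close>

lemma ktree_from_swap:
  assumes "ktree_from k X V E" "v \<notin> V" "x \<in> X"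
  shows "ktree_from k (swap v X x) (insert v V) (E \<union> star v X)"
  using assms
proof (induction rule: ktree_from.induct)
  case base
  define W where "W = swap v X x"
  have W: "finite W" "card W = k" "x \<notin> W" "insert x W = insert v X"
    using base card_Suc_Diff1[of X x] by (auto simp: W_def swap_def)
  have "ktree_from k W (insert x W) (complete_edges W \<union> star x W)"
    using W by (intro ktree_from.step ktree_from.base) (auto simp: k_clique_altdef)
  also have "complete_edges W \<union> star x W = complete_edges X \<union> star v X"
    using W base complete_edges_insert[of x W] complete_edges_insert[of v X] by simp
  finally show ?case
    using W by (simp add: W_def)
next
  case (step V E u Y)
  have "ktree_from k (swap v X x) (insert u (insert v V)) ((E \<union> star v X) \<union> star u Y)"
  proof (rule ktree_from.step)
    show "ktree_from k (swap v X x) (insert v V) (E \<union> star v X)"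
      using step by simp
    show "k_clique k (insert v V) (E \<union> star v X) Y"
      using step by (auto simp: k_clique_def is_clique_def)
  qed (use step in auto)
  then show ?case
    by (simp add: insert_commute Un_ac)
qed

text \<open>The contraction must end with \<open>C\<close> alone and never delete a vertex of
  \<open>C\<close>. If \<open>C\<close> contains the last vertex, it is a swap of \<open>X\<close>,
  and a construction rooted at \<open>X\<close> is converted.\<close>

lemma ktree_imp_ktree_from:
  assumes "ktree k V E" "C \<in> cliques k (V, E)" "1 \<le> k"
  shows "ktree_from k C V E"
  using assms
proof (induction arbitrary: C rule: ktree_induct)
  case (base V)
  then have "C = V"
    using cliques_full[of V k] by (simp add: full_def)
  then show ?case
    using base by (auto intro: ktree_from.base)
next
  case (step V E v X)
  have X: "X \<in> cliques k (V, E)"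
    using step by (simp add: cliques_def)
  have "C \<in> cliques k (V, E) \<union> swap v X ` X"
    using cliques_cone(1)[OF step.hyps(1,2) X step.prems(2)] step.prems(1) by (simp add: cone_def)
  then show ?case
  proof
    assume "C \<in> cliques k (V, E)"
    then show ?thesis
      using step by (intro ktree_from.step)
  next
    assume "C \<in> swap v X ` X"
    then show ?thesis
      using step X by (auto intro: ktree_from_swap)
  qed
qed

section \<open>Inequalities for branches\<close>

text \<open>
  Think of a k-tree hanging below a k-clique Y, the root. Then N is the number of its sub-k-trees
  containing Y, \<open>k + m\<close> their mean order, n the number of all its sub-k-trees and r the sum of the
  orders of those. The first conjunct is all that is needed of the integrality of N. The last one is
  the theorem with an additive gain that makes the induction close; the bound on n is sharp for
  k-trees with at most \<open>k + 1\<close> vertices.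
\<close>

definition weight_inv :: "real \<Rightarrow> real \<Rightarrow> real \<Rightarrow> real \<Rightarrow> real \<Rightarrow> bool" where
  "weight_inv k N m n r \<longleftrightarrow>
     (N = 1 \<or> 2 \<le> N) \<and> 0 \<le> m \<and> 2 * m \<le> N - 1 \<and>
     n \<le> (k + m) * N - (k - 1) \<and> k \<le> 2 * r - (k + m) * n"

section \<open>Product inequalities for independent branches\<close>

lemma one_plus_sum_le_prod:
  fixes N :: "'b \<Rightarrow> real"
  assumes "finite I" "\<And>i. i \<in> I \<Longrightarrow> 1 \<le> N i"
  shows "1 + (\<Sum>i\<in>I. N i - 1) \<le> (\<Prod>i\<in>I. N i)"
  using assms
proof (induction I rule: finite_induct)
  case (insert t I)
  have "1 + (\<Sum>i\<in>I. N i - 1) \<le> (\<Prod>i\<in>I. N i)"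
    using insert by simp
  moreover have "1 \<le> (\<Prod>i\<in>I. N i)"
    using insert by (intro prod_ge_1) auto
  moreover have "0 \<le> (N t - 1) * ((\<Prod>i\<in>I. N i) - 1)"
    using insert calculation by (intro mult_nonneg_nonneg) auto
  ultimately show ?case
    using insert by (simp add: algebra_simps)
qed auto

text \<open>With \<open>m i\<close> raised to \<open>(N i - 1) / 2\<close>, the left side is the sum
  of the first two elementary symmetric functions of the \<open>N i - 1\<close>; the right side is
  the sum of all of them from the first on.\<close>

lemma sum_cross_le_prod:
  fixes N m :: "'b \<Rightarrow> real"
  assumes "finite I" "\<And>i. i \<in> I \<Longrightarrow> 1 \<le> N i" "\<And>i. i \<in> I \<Longrightarrow> 2 * m i \<le> N i - 1"
  shows "(\<Sum>i\<in>I. (1 + sum m I - m i) * (N i - 1)) \<le> (\<Prod>i\<in>I. N i) - 1"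
  using assms
proof (induction I rule: finite_induct)
  case (insert t I)
  define A where "A = (\<Sum>i\<in>I. N i - 1)"
  have IH: "(\<Sum>i\<in>I. (1 + sum m I - m i) * (N i - 1)) \<le> (\<Prod>i\<in>I. N i) - 1"
    using insert by simp
  have A: "1 + A \<le> (\<Prod>i\<in>I. N i)"
    unfolding A_def using insert by (intro one_plus_sum_le_prod) auto
  have A0: "0 \<le> A"
    unfolding A_def using insert by (intro sum_nonneg) auto
  have "(\<Sum>i\<in>I. 2 * m i) \<le> A"
    unfolding A_def using insert by (intro sum_mono) auto
  then have mA: "2 * sum m I \<le> A"
    by (simp add: sum_distrib_left)
  have t: "1 \<le> N t" "2 * m t \<le> N t - 1"
    using insert by auto
  have "(\<Sum>i\<in>insert t I. (1 + sum m (insert t I) - m i) * (N i - 1))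
      = (1 + sum m I) * (N t - 1) + (\<Sum>i\<in>I. (1 + sum m I - m i) * (N i - 1) + m t * (N i - 1))"
    using insert by (simp add: algebra_simps)
  also have "\<dots> = (1 + sum m I) * (N t - 1) + (\<Sum>i\<in>I. (1 + sum m I - m i) * (N i - 1)) + m t * A"
    by (simp add: sum.distrib A_def sum_distrib_left)
  also have "\<dots> \<le> (1 + A / 2) * (N t - 1) + ((\<Prod>i\<in>I. N i) - 1) + (N t - 1) / 2 * A"
    using IH mA t A0 by (intro add_mono mult_right_mono) auto
  also have "\<dots> = (1 + A) * (N t - 1) + ((\<Prod>i\<in>I. N i) - 1)"
    by (simp add: field_simps)
  also have "\<dots> \<le> (\<Prod>i\<in>I. N i) * (N t - 1) + ((\<Prod>i\<in>I. N i) - 1)"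
    using A t by (intro add_mono mult_right_mono) auto
  also have "\<dots> = (\<Prod>i\<in>insert t I. N i) - 1"
    using insert by (simp add: algebra_simps)
  finally show ?case .
qed auto

lemma branch_mean_le:
  fixes N m :: "'b \<Rightarrow> real"
  assumes "finite I" "\<And>i. i \<in> I \<Longrightarrow> 1 \<le> N i" "\<And>i. i \<in> I \<Longrightarrow> 2 * m i \<le> N i - 1"
  shows "1 + 2 * sum m I \<le> (\<Prod>i\<in>I. N i)"
proof -
  have "(\<Sum>i\<in>I. 2 * m i) \<le> (\<Sum>i\<in>I. N i - 1)"
    using assms by (intro sum_mono) auto
  then show ?thesis
    using one_plus_sum_le_prod[of I N] assms by (simp add: sum_distrib_left)
qed

text \<open>The bound on \<open>n i\<close> reads \<open>k * (N i - 1) + 1 + m i * N i\<close>. Over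
  \<open>k\<close> branches the ones add up to \<open>k\<close>, which compensates the
  \<open>-1\<close> in \<open>k * (p - 1)\<close>.\<close>

lemma branch_total_le:
  fixes N m n :: "'b \<Rightarrow> real"
  assumes "finite I" and k: "real (card I) = k" "1 \<le> k"
    and inv: "\<And>i. i \<in> I \<Longrightarrow> weight_inv k (N i) (m i) (n i) (r i)"
  shows "sum n I \<le> (\<Prod>i\<in>I. N i) * (k + sum m I)"
proof -
  define p where "p = (\<Prod>i\<in>I. N i)"
  have N1: "1 \<le> N i" and m0: "0 \<le> m i" if "i \<in> I" for i
    using inv[OF that] by (auto simp: weight_inv_def)
  have Np: "N i \<le> p" if "i \<in> I" for i
  proof -
    have "p = N i * prod N (I - {i})"
      unfolding p_def using assms(1) that by (rule prod.remove)
    moreover have "1 \<le> prod N (I - {i})"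
      using N1 by (intro prod_ge_1) auto
    ultimately show ?thesis
      using mult_left_mono[of 1 "prod N (I - {i})" "N i"] N1[OF that] by simp
  qed
  have "sum n I \<le> (\<Sum>i\<in>I. k * (N i - 1) + 1 + p * m i)"
  proof (rule sum_mono)
    fix i assume i: "i \<in> I"
    have "n i \<le> (k + m i) * N i - (k - 1)"
      using inv[OF i] by (simp add: weight_inv_def)
    also have "\<dots> = k * (N i - 1) + 1 + N i * m i"
      by (simp add: algebra_simps)
    also have "N i * m i \<le> p * m i"
      using Np[OF i] m0[OF i] by (rule mult_right_mono)
    finally show "n i \<le> k * (N i - 1) + 1 + p * m i"
      by simp
  qed
  also have "\<dots> = k * (\<Sum>i\<in>I. N i - 1) + k + p * sum m I"
    by (simp add: sum.distrib sum_distrib_left k)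
  also have "\<dots> \<le> k * (p - 1) + k + p * sum m I"
    using one_plus_sum_le_prod[of I N] assms(1) N1 k(2) by (simp add: p_def)
  finally show ?thesis
    by (simp add: p_def algebra_simps)
qed

text \<open>Bounds the loss from measuring each branch against \<open>x\<close> instead of its own
  \<open>m i\<close>. The \<open>k\<^sup>2\<close> on the right is the joint gain of the
  \<open>k\<close> branches.\<close>

lemma branch_cross_le:
  fixes N m n :: "'b \<Rightarrow> real"
  assumes "finite I" and k: "real (card I) = k" "1 \<le> k"
    and inv: "\<And>i. i \<in> I \<Longrightarrow> weight_inv k (N i) (m i) (n i) (r i)"
  defines "p \<equiv> \<Prod>i\<in>I. N i" and "q \<equiv> 1 + sum m I"
  defines "x \<equiv> p * q / (1 + p)"
  shows "(\<Sum>i\<in>I. (x - m i) * n i) \<le> k * p + p * q + k\<^sup>2"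
proof -
  define P where "P i = prod N (I - {i})" for i
  define M where "M i = sum m (I - {i})" for i
  define A where "A = (\<Sum>i\<in>I. N i - 1)"
  define \<Sigma> where "\<Sigma> = sum m I"
  define S where "S = (\<Sum>i\<in>I. m i * N i * (P i - 1 - M i))"
  have Ncase: "N i = 1 \<or> 2 \<le> N i" and m0: "0 \<le> m i" and mN: "2 * m i \<le> N i - 1"
    and n: "n i \<le> k * (N i - 1) + 1 + m i * N i" if "i \<in> I" for i
    using inv[OF that] by (auto simp: weight_inv_def algebra_simps)
  have N1: "1 \<le> N i" if "i \<in> I" for i
    using Ncase[OF that] by auto
  have pP: "p = N i * P i" if "i \<in> I" for i
    unfolding p_def P_def using assms(1) that by (rule prod.remove)
  have SM: "\<Sigma> = m i + M i" if "i \<in> I" for i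
    unfolding \<Sigma>_def M_def using assms(1) that by (rule sum.remove)
  have PM: "1 + 2 * M i \<le> P i" for i
    unfolding P_def M_def using assms(1) N1 mN by (intro branch_mean_le) auto
  have M0: "0 \<le> M i" for i
    unfolding M_def using m0 by (intro sum_nonneg) auto
  have \<Sigma>0: "0 \<le> \<Sigma>"
    unfolding \<Sigma>_def using m0 by (intro sum_nonneg) auto
  have P1: "1 \<le> P i" for i
    using PM[of i] M0[of i] by linarith
  have p1: "1 \<le> p"
    unfolding p_def using N1 by (intro prod_ge_1) auto
  have q: "q = 1 + \<Sigma>"
    by (simp add: q_def \<Sigma>_def)
  have xq: "x = q - q / (1 + p)"
    unfolding x_def using p1 by (simp add: field_simps)
  have A0: "0 \<le> A"
    unfolding A_def using N1 by (intro sum_nonneg) auto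
  \<comment> \<open>The sign permits inserting the upper bound on \<open>n i\<close> below.\<close>
  have coeff: "0 \<le> x - m i" if i: "i \<in> I" for i
  proof -
    have "N i \<le> p"
      using pP[OF i] P1[of i] N1[OF i] mult_left_mono[of 1 "P i" "N i"] by simp
    then have "m i \<le> p"
      using mN[OF i] p1 by linarith
    then have "m i * (1 + p) \<le> p * (1 + m i)"
      by (simp add: algebra_simps)
    also have "\<dots> \<le> p * q"
      using SM[OF i] M0[of i] p1 q by (intro mult_left_mono) auto
    finally show ?thesis
      unfolding x_def using p1 by (simp add: field_simps)
  qed
  have S0: "0 \<le> S"
    unfolding S_def
  proof (rule sum_nonneg)
    fix i assume i: "i \<in> I"
    show "0 \<le> m i * N i * (P i - 1 - M i)"
      using m0[OF i] N1[OF i] PM[of i] M0[of i] by (intro mult_nonneg_nonneg) linarith+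
  qed
  have cross: "(\<Sum>i\<in>I. (1 + M i) * (N i - 1)) \<le> p - 1"
  proof -
    have "(\<Sum>i\<in>I. (1 + M i) * (N i - 1)) = (\<Sum>i\<in>I. (1 + sum m I - m i) * (N i - 1))"
      using SM by (intro sum.cong) (auto simp: \<Sigma>_def)
    then show ?thesis
      unfolding p_def using sum_cross_le_prod[of I N m] assms(1) N1 mN by simp
  qed
  have "(\<Sum>i\<in>I. (x - m i) * n i) \<le> (\<Sum>i\<in>I. (x - m i) * (k * (N i - 1) + 1 + m i * N i))"
    using coeff n by (intro sum_mono mult_left_mono)
  also have "\<dots> \<le> (\<Sum>i\<in>I. p * m i - m i * N i * (P i - 1 - M i) + (1 + \<Sigma>)
      + k * ((1 + M i) * (N i - 1)) - q / (1 + p) * k * (N i - 1))"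
  \<comment> \<open>Of the part multiplied by \<open>q / (1 + p)\<close> only the share with
    \<open>k * (N i - 1)\<close> is kept. Since \<open>p = N i * P i\<close>, the product
    \<open>(1 + M i) * m i * N i\<close> is \<open>p * m i\<close> minus a deficit, and these
    deficits form \<open>S\<close>.\<close>
  proof (rule sum_mono)
    fix i assume i: "i \<in> I"
    have xm: "x - m i = 1 + M i - q / (1 + p)"
      using xq q SM[OF i] by simp
    have "0 \<le> q / (1 + p) * (1 + m i * N i)"
      using q \<Sigma>0 p1 m0[OF i] N1[OF i] by (intro mult_nonneg_nonneg divide_nonneg_nonneg add_nonneg_nonneg) auto
    moreover have "(x - m i) * (k * (N i - 1) + 1 + m i * N i)
       = (1 + M i) * (k * (N i - 1) + 1 + m i * N i) - q / (1 + p) * k * (N i - 1)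
        - q / (1 + p) * (1 + m i * N i)"
      unfolding xm by algebra
    ultimately have "(x - m i) * (k * (N i - 1) + 1 + m i * N i)
       \<le> (1 + M i) * (k * (N i - 1) + 1 + m i * N i) - q / (1 + p) * k * (N i - 1)"
      by linarith
    also have "\<dots> = N i * P i * m i - m i * N i * (P i - 1 - M i) + (1 + M i)
      + k * ((1 + M i) * (N i - 1)) - q / (1 + p) * k * (N i - 1)"
      by (simp add: algebra_simps)
    finally show "(x - m i) * (k * (N i - 1) + 1 + m i * N i)
      \<le> p * m i - m i * N i * (P i - 1 - M i) + (1 + \<Sigma>)
      + k * ((1 + M i) * (N i - 1)) - q / (1 + p) * k * (N i - 1)"
      using pP[OF i] SM[OF i] m0[OF i] by simp
  qed
  also have "\<dots> = p * \<Sigma> - S + k * q + k * (\<Sum>i\<in>I. (1 + M i) * (N i - 1)) - q / (1 + p) * k * A"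
    unfolding S_def A_def \<Sigma>_def q_def
    by (simp only: sum.distrib sum_subtractf k(1) sum_constant distrib_left flip: sum_distrib_left)
  also have "\<dots> \<le> p * \<Sigma> - S + k * q + k * (p - 1) - q / (1 + p) * k * A"
    using cross k(2) by simp
  finally have main: "(\<Sum>i\<in>I. (x - m i) * n i)
      \<le> p * \<Sigma> - S + k * q + k * (p - 1) - q / (1 + p) * k * A" .
  \<comment> \<open>If at most one branch is nontrivial, the subtracted term absorbs \<open>k * \<Sigma>\<close>.
    Otherwise each \<open>P i\<close> is at least 2, hence \<open>\<Sigma>\<^sup>2 \<le> S\<close> and AM-GM applies.\<close>
  have "k * \<Sigma> - q / (1 + p) * k * A \<le> S + p + k\<^sup>2"
  proof (cases "\<exists>i\<in>I. P i = 1")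
    case True
    then obtain i where i: "i \<in> I" "P i = 1"
      by blast
    have "0 \<le> (\<Sum>j\<in>I - {i}. N j - 1)"
      using N1 by (intro sum_nonneg) auto
    then have Ap: "p - 1 \<le> A"
      using pP[OF i(1)] i assms(1) by (simp add: A_def sum.remove[of I i])
    have A\<Sigma>: "2 * \<Sigma> \<le> A"
      unfolding \<Sigma>_def A_def sum_distrib_left using mN by (intro sum_mono) auto
    have pA: "p = 1 + A"
      using Ap one_plus_sum_le_prod[of I N] assms(1) N1 by (simp add: p_def A_def)
    \<comment> \<open>With \<open>p = 1 + A\<close> and \<open>q = 1 + \<Sigma>\<close> this is just
      \<open>2 * \<Sigma> \<le> A\<close>.\<close>
    have "\<Sigma> * (1 + p) \<le> q * A"
      using A\<Sigma> unfolding q pA by (simp add: algebra_simps)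
    then have "\<Sigma> \<le> q / (1 + p) * A"
      using p1 by (simp add: field_simps)
    then have "k * \<Sigma> \<le> k * (q / (1 + p) * A)"
      using k(2) by (intro mult_left_mono) auto
    moreover have "k * (q / (1 + p) * A) = q / (1 + p) * k * A"
      by simp
    ultimately show ?thesis
      using S0 p1 zero_le_power2[of k] by linarith
  next
    case False
    \<comment> \<open>Here integrality enters: some branch other than \<open>i\<close> is
      nontrivial, so its count is at least 2.\<close>
    have P2: "2 \<le> P i" if i: "i \<in> I" for i
    proof -
      obtain j where j: "j \<in> I - {i}" "N j \<noteq> 1"
      proof (rule ccontr)
        assume "\<not> thesis"
        then have "\<And>j. j \<in> I - {i} \<Longrightarrow> N j = 1"
          using that by blast
        then have "P i = 1"
          unfolding P_def by (intro prod.neutral) auto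
        then show False
          using False i by blast
      qed
      then have "1 \<le> N j - 1"
        using Ncase[of j] by auto
      also have "\<dots> \<le> (\<Sum>j\<in>I - {i}. N j - 1)"
        using j assms(1) N1 by (intro member_le_sum) auto
      finally show ?thesis
        using one_plus_sum_le_prod[of "I - {i}" N] N1 assms(1) by (simp add: P_def)
    qed
    have "\<Sigma>\<^sup>2 = (\<Sum>i\<in>I. m i * \<Sigma>)"
      by (simp add: \<Sigma>_def power2_eq_square sum_distrib_right)
    also have "\<dots> \<le> S"
      unfolding S_def
    proof (rule sum_mono)
      fix i assume i: "i \<in> I"
      \<comment> \<open>Now \<open>m i\<close> and \<open>M i\<close> are both bounded by multiples
        of \<open>(P i - 1) / 2\<close>, and the resulting factor \<open>1 + 2 * m i\<close> is at
        most \<open>N i\<close>.\<close>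
      have "m i * 1 \<le> m i * (P i - 1)" 
        using P2[OF i] m0[OF i] by (intro mult_left_mono) auto
      then have "\<Sigma> \<le> (1 + 2 * m i) * ((P i - 1) / 2)"
        using SM[OF i] PM[of i] by (simp add: algebra_simps)
      also have "\<dots> \<le> N i * (P i - 1 - M i)"
        using mN[OF i] m0[OF i] PM[of i] P1[of i] by (intro mult_mono) auto
      finally show "m i * \<Sigma> \<le> m i * N i * (P i - 1 - M i)"
        using mult_left_mono[OF _ m0[OF i]] by (simp add: mult.assoc)
    qed
    finally have "\<Sigma>\<^sup>2 \<le> S" .
    moreover have "k * \<Sigma> \<le> k\<^sup>2 + \<Sigma>\<^sup>2"
    proof -
      have "0 \<le> k * \<Sigma>"
        using k \<Sigma>0 by simp
      then show ?thesis
        using sum_squares_bound[of k \<Sigma>] by linarith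
    qed
    moreover have "0 \<le> q / (1 + p) * k * A"
      using q \<Sigma>0 p1 k A0 by simp
    ultimately show ?thesis
      using p1 by linarith
  qed
  then show ?thesis
    using main q by (simp add: algebra_simps)
qed

text \<open>
  The effect on the root of hanging one new vertex below it, whose new k-cliques are themselves
  roots with parameters Ni, mi, ni, ri: a sub-k-tree containing the root either avoids the new
  vertex or is extended independently below each new clique.
\<close>

lemma weight_inv_attach:
  fixes Ni mi ni ri :: "'b \<Rightarrow> real"
  assumes "finite I" and k: "real (card I) = k" "1 \<le> k"
    and invX: "weight_inv k N m n r"
    and inv: "\<And>i. i \<in> I \<Longrightarrow> weight_inv k (Ni i) (mi i) (ni i) (ri i)"
  defines "p \<equiv> \<Prod>i\<in>I. Ni i" and "q \<equiv> 1 + sum mi I"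
  defines "x \<equiv> p * q / (1 + p)"
  shows "weight_inv k (N * (1 + p)) (m + x) (N * p + n + sum ni I)
    ((k + (m + x)) * (N * (1 + p)) + r - (k + m) * N + sum ri I)"
proof -
  have N1: "1 \<le> N" and m0: "0 \<le> m" and mN: "2 * m \<le> N - 1"
    and n: "n \<le> (k + m) * N - (k - 1)" and r: "k \<le> 2 * r - (k + m) * n"
    using invX by (auto simp: weight_inv_def)
  have Ni1: "1 \<le> Ni i" and mi0: "0 \<le> mi i" and miN: "2 * mi i \<le> Ni i - 1"
    and ri: "k \<le> 2 * ri i - (k + mi i) * ni i" if "i \<in> I" for i
    using inv[OF that] by (auto simp: weight_inv_def)
  have p1: "1 \<le> p"
    unfolding p_def using Ni1 by (intro prod_ge_1) auto
  have q1: "1 \<le> q"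
    unfolding q_def using mi0 by (simp add: sum_nonneg)
  have x0: "0 \<le> x"
    unfolding x_def using p1 q1 by simp
  have xpq: "p * q = x + p * x"
  proof -
    have "(1 + p) * x = p * q"
      unfolding x_def using p1 by simp
    then show ?thesis
      by (simp add: algebra_simps)
  qed
  have qp: "2 * q \<le> 1 + p"
    using branch_mean_le[of I Ni mi] assms(1) Ni1 miN by (simp add: p_def q_def)
  have "(1 + p) * (2 * x) \<le> (1 + p) * p"
    using mult_left_mono[OF qp, of p] p1 xpq by (simp add: algebra_simps)
  then have xp: "2 * x \<le> p"
    using p1 by simp
  have tot: "sum ni I \<le> (k - 1) * p + p * q"
    using branch_total_le[OF assms(1) k inv] by (simp add: p_def q_def algebra_simps)
  have cr: "(\<Sum>i\<in>I. (x - mi i) * ni i) \<le> k * p + p * q + k\<^sup>2"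
    unfolding x_def p_def q_def by (rule branch_cross_le[OF assms(1) k inv])
  define b where "b = N - 1"
  have b: "N = 1 + b" "0 \<le> b" "2 * m \<le> b"
    using N1 mN by (auto simp: b_def)
  have "2 \<le> N * (1 + p)"
    using mult_mono[of 1 N 2 "1 + p"] N1 p1 by simp
  moreover have "0 \<le> m + x"
    using m0 x0 by simp
  moreover have "2 * (m + x) \<le> N * (1 + p) - 1"
  proof -
    have "p \<le> N * p"
      using mult_right_mono[OF N1, of p] p1 by simp
    then show ?thesis
      using xp mN by (simp add: algebra_simps)
  qed
  moreover have "N * p + n + sum ni I \<le> (k + (m + x)) * (N * (1 + p)) - (k - 1)"
  proof -
    have "(k - 1) * p \<le> (k - 1) * p * N" "p * q \<le> p * q * N" "0 \<le> m * N * p"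
      using mult_left_mono[OF N1, of "(k - 1) * p"] mult_left_mono[OF N1, of "p * q"]
        k p1 q1 m0 N1 by auto
    then have "N * p + ((k + m) * N - (k - 1)) + ((k - 1) * p + p * q)
        \<le> (k + m) * (N * (1 + p)) + p * q * N - (k - 1)"
      by (simp add: algebra_simps)
    also have "p * q * N = x * (N * (1 + p))"
      by (simp add: xpq algebra_simps)
    finally have "N * p + ((k + m) * N - (k - 1)) + ((k - 1) * p + p * q)
        \<le> (k + (m + x)) * (N * (1 + p)) - (k - 1)"
      by (simp add: algebra_simps)
    then show ?thesis
      using n tot by linarith
  qed
  moreover have "k \<le> 2 * ((k + (m + x)) * (N * (1 + p)) + r - (k + m) * N + sum ri I)
      - (k + (m + x)) * (N * p + n + sum ni I)"
  proof -
    have "(\<Sum>i\<in>I. k + (k + mi i) * ni i) \<le> (\<Sum>i\<in>I. 2 * ri i)"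
      using ri by (intro sum_mono) (simp add: algebra_simps)
    \<comment> \<open>The gains of the \<open>k\<close> branches add up to the
      \<open>k\<^sup>2\<close> that cancels the one in \<open>C\<close>.\<close>
    then have R: "k\<^sup>2 + k * sum ni I + (\<Sum>i\<in>I. mi i * ni i) \<le> 2 * sum ri I"
      by (simp add: sum.distrib sum_distrib_left k(1) power2_eq_square distrib_right)
    have C: "x * sum ni I - (\<Sum>i\<in>I. mi i * ni i) \<le> k * p + p * q + k\<^sup>2"
      using cr by (simp add: left_diff_distrib sum_subtractf sum_distrib_left)
    have T: "m * sum ni I \<le> m * ((k - 1) * p + p * q)"
      using tot m0 by (rule mult_left_mono)
    have X: "x * n \<le> x * ((k + m) * N - (k - 1))"
      using n x0 by (rule mult_left_mono)
    \<comment> \<open>This is what remains after inserting the four bounds. As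
      \<open>p * q = x + p * x\<close>, both sides agree when \<open>N = 1\<close>, where
      \<open>m = 0\<close>. With \<open>N = 1 + b\<close> every remaining term has a factor
      \<open>b\<close> or \<open>m\<close>, and \<open>m \<le> b / 2\<close> and
      \<open>x \<le> p / 2\<close> suffice.\<close>
    have "x * (k + m) * N - x * (k - 1) + m * (k - 1) * p + m * (p * q) + k * p + p * q
        \<le> 2 * x * N + (k + m + x) * N * p"
    proof -
      have 1: "2 * (m * p * x) \<le> b * p * x"
        using mult_right_mono[OF b(3), of "p * x"] p1 x0 by (simp add: algebra_simps)
      have 2: "2 * (m * x) \<le> b * x"
        using mult_right_mono[OF b(3), of x] x0 by (simp add: algebra_simps)
      have 3: "2 * (x * m * N) \<le> p * m * N"
        using mult_right_mono[OF xp, of "m * N"] m0 N1 by (simp add: algebra_simps)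
      have 4: "2 * (k * x * b) \<le> k * p * b"
        using mult_right_mono[OF xp, of "k * b"] k b by (simp add: algebra_simps)
      have 5: "2 * (m * (k - 1) * p) \<le> b * (k - 1) * p"
        using mult_right_mono[OF b(3), of "(k - 1) * p"] k p1 by (simp add: algebra_simps)
      have 6: "0 \<le> b * p * x" "0 \<le> b * x" "0 \<le> p * m * N" "0 \<le> b * p"
        using b p1 x0 m0 N1 by auto
      show ?thesis
        using 1 2 3 4 5 6 x0 unfolding xpq b(1) by (simp add: algebra_simps)
    qed
    then have "k \<le> 2 * (k + (m + x)) * (N * (1 + p)) + (k + (k + m) * n) - 2 * (k + m) * N
        + (k\<^sup>2 + k * sum ni I + (\<Sum>i\<in>I. mi i * ni i))
        - (k + (m + x)) * (N * p + n + sum ni I)"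
      using C T X by (simp add: algebra_simps)
    then show ?thesis
      using R r by (simp add: algebra_simps)
  qed
  ultimately show ?thesis
    by (simp add: weight_inv_def)
qed

section \<open>Contraction of branches\<close>

text \<open>Counts the ways to extend \<open>S\<close> into the contracted parts: the choices below
  distinct cliques are independent.\<close>

definition clique_weight :: "nat \<Rightarrow> ('a set \<Rightarrow> real) \<Rightarrow> 'a set \<times> 'a set set \<Rightarrow> real" where
  "clique_weight k N S = (\<Prod>Y\<in>cliques k S. N Y)"

text \<open>The mean order of these extensions, as mean excesses add over independent
  choices.\<close>

definition clique_order :: "nat \<Rightarrow> ('a set \<Rightarrow> real) \<Rightarrow> 'a set \<times> 'a set set \<Rightarrow> real" where
  "clique_order k m S = real (card (fst S)) + (\<Sum>Y\<in>cliques k S. m Y)"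

lemma weights_full:
  assumes "finite Y" "card Y = k"
  shows "clique_weight k N (full Y) = N Y" "clique_order k m (full Y) = real k + m Y"
  using cliques_full[OF assms] assms by (auto simp: clique_weight_def clique_order_def full_def)

lemma weights_cone:
  assumes T: "ktree k (fst S) (snd S)" and v: "v \<notin> fst S" and X: "X \<in> cliques k S" and k: "1 \<le> k"
  shows "clique_weight k N (cone v X S) = clique_weight k N S * (\<Prod>x\<in>X. N (swap v X x))"
    and "clique_order k m (cone v X S) = clique_order k m S + (1 + (\<Sum>x\<in>X. m (swap v X x)))"
proof -
  have X': "finite X" "v \<notin> X"
    using X v by (auto simp: cliques_def k_clique_def)
  have c: "cliques k (cone v X S) = cliques k S \<union> swap v X ` X"
    and d: "cliques k S \<inter> swap v X ` X = {}"
    using cliques_cone[of k "fst S" "snd S" v X] T v X k by simp_all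
  have f: "finite (cliques k S)"
    using finite_cliques[OF T] by simp
  have inj: "inj_on (swap v X) X"
    using X' by (intro inj_on_swap)
  show "clique_weight k N (cone v X S) = clique_weight k N S * (\<Prod>x\<in>X. N (swap v X x))"
    unfolding clique_weight_def c using d f X' inj
    by (simp add: prod.union_disjoint prod.reindex)
  have "card (fst (cone v X S)) = Suc (card (fst S))"
    using v ktree_wf(1)[OF T] by (simp add: cone_def)
  then show "clique_order k m (cone v X S) = clique_order k m S + (1 + (\<Sum>x\<in>X. m (swap v X x)))"
    unfolding clique_order_def c using d f X' inj
    by (simp add: sum.union_disjoint sum.reindex)
qed

lemma weights_update:
  assumes "finite (cliques k S)"
  shows "clique_weight k (N(X := N X * a)) S = clique_weight k N S * (if X \<in> cliques k S then a else 1)"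
    and "clique_order k (m(X := m X + b)) S = clique_order k m S + (if X \<in> cliques k S then b else 0)"
proof -
  have "clique_weight k (N(X := N X * a)) S = (\<Prod>Y\<in>cliques k S. N Y * (if Y = X then a else 1))"
    unfolding clique_weight_def by (intro prod.cong) auto
  then show "clique_weight k (N(X := N X * a)) S
      = clique_weight k N S * (if X \<in> cliques k S then a else 1)"
    using assms by (simp add: clique_weight_def prod.distrib prod.delta)
  have "(\<Sum>Y\<in>cliques k S. (m(X := m X + b)) Y) = (\<Sum>Y\<in>cliques k S. m Y + (if Y = X then b else 0))"
    by (intro sum.cong) auto
  then show "clique_order k (m(X := m X + b)) S
      = clique_order k m S + (if X \<in> cliques k S then b else 0)"
    using assms by (simp add: clique_order_def sum.distrib sum.delta)
qed

text \<open>
  A clique weighted with (N, m, n, r) stands for a contracted k-tree hanging below it; the sums over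
  cliques account for the sub-k-trees of the contracted parts that do not contain their root.
\<close>

lemma weighted_mean_bound:
  assumes "ktree_from k C V E" "1 \<le> k"
    and "\<And>Y. Y \<in> cliques k (V, E) \<Longrightarrow> weight_inv (real k) (N Y) (m Y) (n Y) (r Y)"
  shows "real k * (\<Sum>S\<in>sub_ktrees k V E. if C \<in> cliques k S then clique_weight k N S else 0)
    \<le> 2 * ((\<Sum>S\<in>sub_ktrees k V E. clique_weight k N S * clique_order k m S)
          + (\<Sum>Y\<in>cliques k (V, E). r Y - (real k + m Y) * N Y))
        * (\<Sum>S\<in>sub_ktrees k V E. if C \<in> cliques k S then clique_weight k N S else 0)
      - (\<Sum>S\<in>sub_ktrees k V E. if C \<in> cliques k S then clique_weight k N S * clique_order k m S else 0)
        * ((\<Sum>S\<in>sub_ktrees k V E. clique_weight k N S) + (\<Sum>Y\<in>cliques k (V, E). n Y - N Y))"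
  using assms
proof (induction arbitrary: N m n r rule: ktree_from.induct)
  case base
  have c: "cliques k (C, complete_edges C) = {C}"
    using cliques_full base unfolding full_def by blast
  have inv: "weight_inv (real k) (N C) (m C) (n C) (r C)"
    using base c by simp
  \<comment> \<open>For a single clique the corrections turn the global sums into \<open>r C\<close>
    and \<open>n C\<close>, so the claim is the last conjunct of \<open>weight_inv\<close> times
    \<open>N C\<close>.\<close>
  then have "N C * real k \<le> N C * (2 * r C - (real k + m C) * n C)"
    by (intro mult_left_mono) (auto simp: weight_inv_def)
  then show ?case
    using base by (simp add: sub_ktrees_full cliques_full c weights_full algebra_simps)
next
  case (step V E v X)
  have T: "ktree k V E"
    using step.hyps(1) by (rule ktree_from_imp_ktree)
  have v: "v \<notin> V" and k: "1 \<le> k" and X: "X \<in> cliques k (V, E)"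
    using step by (auto simp: cliques_def)
  have X': "X \<subseteq> V" "finite X" "card X = k" "v \<notin> X"
    using X v by (auto simp: cliques_def k_clique_def)
  have cl: "cliques k (insert v V, E \<union> star v X) = cliques k (V, E) \<union> swap v X ` X"
    and disj: "cliques k (V, E) \<inter> swap v X ` X = {}"
    using cliques_cone[OF T v X k] by (auto simp: cone_def)
  have fin: "finite (cliques k (V, E))"
    by (rule finite_cliques[OF T])
  have swap: "finite (swap v X x)" "card (swap v X x) = k" "v \<in> swap v X x" if "x \<in> X" for x
    using that X' card_Suc_Diff1[of X x] by (auto simp: swap_def)
  define p where "p = (\<Prod>x\<in>X. N (swap v X x))"
  define q where "q = 1 + (\<Sum>x\<in>X. m (swap v X x))"
  \<comment> \<open>The mean excess over \<open>1 + p\<close> continuations at \<open>X\<close>: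
    omit \<open>v\<close>, or add it in one of \<open>p\<close> ways with \<open>q\<close> further
    vertices on average.\<close>
  define \<xi> where "\<xi> = p * q / (1 + p)"
  define \<nu> where "\<nu> = (\<Sum>x\<in>X. n (swap v X x))"
  define \<rho> where "\<rho> = (\<Sum>x\<in>X. r (swap v X x))"
  define N' where "N' = N(X := N X * (1 + p))"
  define m' where "m' = m(X := m X + \<xi>)"
  \<comment> \<open>The summands count sub-k-trees using both \<open>X\<close> and \<open>v\<close>,
    those avoiding \<open>v\<close>, and those below a new clique. In \<open>r'\<close> the orders
    of those containing \<open>X\<close> are replaced by their new total.\<close>
  define n' where "n' = n(X := N X * p + n X + \<nu>)"
  define r' where "r' = r(X := (real k + (m X + \<xi>)) * (N X * (1 + p)) + r X
    - (real k + m X) * N X + \<rho>)"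
  have inv_swap: "weight_inv (real k) (N (swap v X x)) (m (swap v X x)) (n (swap v X x)) (r (swap v X x))"
    if "x \<in> X" for x
    using step.prems(2)[of "swap v X x"] that cl by blast
  have "1 \<le> p"
    unfolding p_def using inv_swap by (intro prod_ge_1) (force simp: weight_inv_def)
  then have \<xi>: "(1 + p) * \<xi> = p * q"
    by (simp add: \<xi>_def)
  have inv': "weight_inv (real k) (N' Y) (m' Y) (n' Y) (r' Y)" if Y: "Y \<in> cliques k (V, E)" for Y
  proof (cases "Y = X")
    case True
    have "weight_inv (real k) (N X) (m X) (n X) (r X)"
      using step.prems(2)[of X] X cl by blast
    then show ?thesis
      using weight_inv_attach[of X "real k" "N X" "m X" "n X" "r X" "\<lambda>x. N (swap v X x)"
        "\<lambda>x. m (swap v X x)" "\<lambda>x. n (swap v X x)" "\<lambda>x. r (swap v X x)"] inv_swap X' k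
      unfolding True N'_def m'_def n'_def r'_def p_def q_def \<xi>_def \<nu>_def \<rho>_def by simp
  next
    case False
    then show ?thesis
      using step.prems(2)[of Y] Y cl by (auto simp: N'_def m'_def n'_def r'_def)
  qed
  have S: "ktree k (fst S) (snd S)" "v \<notin> fst S" "finite (cliques k S)" if "S \<in> sub_ktrees k V E" for S
    using that v finite_cliques[of k "fst S" "snd S"] by (auto simp: sub_ktrees_def)
  have weights': "clique_weight k N' S = clique_weight k N S * (if X \<in> cliques k S then 1 + p else 1)"
    "clique_order k m' S = clique_order k m S + (if X \<in> cliques k S then \<xi> else 0)"
    if "S \<in> sub_ktrees k V E" for S
    unfolding N'_def m'_def using S(3)[OF that] by (rule weights_update)+
  have w: "clique_weight k N S + (if X \<in> cliques k S then clique_weight k N (cone v X S) else 0)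
      = clique_weight k N' S" if "S \<in> sub_ktrees k V E" for S
    using weights_cone(1)[OF S(1,2)[OF that] _ k] weights'(1)[OF that]
    by (simp add: p_def distrib_left)
  have wo: "clique_weight k N S * clique_order k m S
       + (if X \<in> cliques k S then clique_weight k N (cone v X S) * clique_order k m (cone v X S) else 0)
      = clique_weight k N' S * clique_order k m' S" if "S \<in> sub_ktrees k V E" for S
  proof (cases "X \<in> cliques k S")
    case True
    have "clique_weight k N' S * clique_order k m' S
        = clique_weight k N S * ((1 + p) * clique_order k m S + (1 + p) * \<xi>)"
      using True weights'[OF that] by (simp add: algebra_simps)
    then show ?thesis
      using True weights_cone[OF S(1,2)[OF that] _ k] unfolding \<xi>
      by (simp add: p_def q_def algebra_simps)
  next
    case False
    then show ?thesis
      using weights'[OF that] by simp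
  qed
  \<comment> \<open>Rooting at \<open>C\<close> pays off: \<open>C\<close> is neither created by a
    cone nor a new clique, so the sums restricted to \<open>C\<close> change only through the
    weights at \<open>X\<close>.\<close>
  have vC: "v \<notin> C"
    using ktree_from_root[OF step.hyps(1)] v by blast
  have C_cone: "C \<in> cliques k (cone v X S) \<longleftrightarrow> C \<in> cliques k S"
    if "S \<in> sub_ktrees k V E" "X \<in> cliques k S" for S
    using cliques_cone(1)[of k "fst S" "snd S" v X] S(1,2)[OF that(1)] that(2) k vC swap(3) by auto
  have C_full: "C \<notin> cliques k (full (swap v X x))" if "x \<in> X" for x
    using cliques_full swap[OF that] vC by blast
  note sum_cone = sum_sub_ktrees_cone[OF T v X k]
  have local_sum: "(\<Sum>S\<in>sub_ktrees k (insert v V) (E \<union> star v X). if C \<in> cliques k S then g S else 0)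
      = (\<Sum>S\<in>sub_ktrees k V E. if C \<in> cliques k S then g' S else 0)"
    if g: "\<And>S. S \<in> sub_ktrees k V E \<Longrightarrow>
      g S + (if X \<in> cliques k S then g (cone v X S) else 0) = g' S"
    for g g' :: "'a set \<times> 'a set set \<Rightarrow> real"
  proof -
    have "(if C \<in> cliques k S then g S else 0)
        + (if X \<in> cliques k S then if C \<in> cliques k (cone v X S) then g (cone v X S) else 0 else 0)
        = (if C \<in> cliques k S then g' S else 0)" if "S \<in> sub_ktrees k V E" for S
      using g[OF that] C_cone[OF that] by (cases "X \<in> cliques k S") auto
    then show ?thesis
      unfolding sum_cone using C_full by simp
  qed
  have loc: "(\<Sum>S\<in>sub_ktrees k (insert v V) (E \<union> star v X). if C \<in> cliques k S then clique_weight k N S else 0)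
      = (\<Sum>S\<in>sub_ktrees k V E. if C \<in> cliques k S then clique_weight k N' S else 0)"
    using w by (rule local_sum)
  have loco: "(\<Sum>S\<in>sub_ktrees k (insert v V) (E \<union> star v X).
        if C \<in> cliques k S then clique_weight k N S * clique_order k m S else 0)
      = (\<Sum>S\<in>sub_ktrees k V E. if C \<in> cliques k S then clique_weight k N' S * clique_order k m' S else 0)"
    using wo by (rule local_sum)
  have sum_cliques: "sum g (cliques k (insert v V, E \<union> star v X))
      = sum g (cliques k (V, E)) + (\<Sum>x\<in>X. g (swap v X x))" for g :: "'a set \<Rightarrow> real"
    unfolding cl using fin disj X' inj_on_swap[of v X]
    by (simp add: sum.union_disjoint sum.reindex)
  have upd: "(\<Sum>Y\<in>cliques k (V, E). g' Y) = (\<Sum>Y\<in>cliques k (V, E). g Y) + (g' X - g X)"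
    if "\<And>Y. Y \<noteq> X \<Longrightarrow> g' Y = g Y" for g g' :: "'a set \<Rightarrow> real"
  proof -
    have "sum g' (cliques k (V, E) - {X}) = sum g (cliques k (V, E) - {X})"
      using that by (intro sum.cong) auto
    then show ?thesis
      using sum.remove[OF fin X, of g] sum.remove[OF fin X, of g'] by simp
  qed
  \<comment> \<open>The bare new cliques contribute their \<open>N\<close>, cancelling the
    \<open>- N\<close> of the corrections and leaving \<open>\<nu>\<close>.\<close>
  have tot: "(\<Sum>S\<in>sub_ktrees k (insert v V) (E \<union> star v X). clique_weight k N S)
        + (\<Sum>Y\<in>cliques k (insert v V, E \<union> star v X). n Y - N Y)
      = (\<Sum>S\<in>sub_ktrees k V E. clique_weight k N' S) + (\<Sum>Y\<in>cliques k (V, E). n' Y - N' Y)"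
  proof -
    have "(\<Sum>Y\<in>cliques k (V, E). n' Y - N' Y) = (\<Sum>Y\<in>cliques k (V, E). n Y - N Y) + \<nu>"
      by (subst upd[where g = "\<lambda>Y. n Y - N Y"]) (auto simp: n'_def N'_def algebra_simps)
    moreover have "(\<Sum>x\<in>X. clique_weight k N (full (swap v X x))) = (\<Sum>x\<in>X. N (swap v X x))"
      using swap by (intro sum.cong) (auto simp: weights_full)
    ultimately show ?thesis
      unfolding sum_cone sum_cliques using w by (simp add: \<nu>_def sum_subtractf)
  qed
  have toto: "(\<Sum>S\<in>sub_ktrees k (insert v V) (E \<union> star v X). clique_weight k N S * clique_order k m S)
        + (\<Sum>Y\<in>cliques k (insert v V, E \<union> star v X). r Y - (real k + m Y) * N Y)
      = (\<Sum>S\<in>sub_ktrees k V E. clique_weight k N' S * clique_order k m' S)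
        + (\<Sum>Y\<in>cliques k (V, E). r' Y - (real k + m' Y) * N' Y)"
  proof -
    have "(\<Sum>Y\<in>cliques k (V, E). r' Y - (real k + m' Y) * N' Y)
        = (\<Sum>Y\<in>cliques k (V, E). r Y - (real k + m Y) * N Y) + \<rho>"
      by (subst upd[where g = "\<lambda>Y. r Y - (real k + m Y) * N Y"])
        (auto simp: r'_def m'_def N'_def algebra_simps)
    moreover have "(\<Sum>x\<in>X. clique_weight k N (full (swap v X x)) * clique_order k m (full (swap v X x)))
        = (\<Sum>x\<in>X. (real k + m (swap v X x)) * N (swap v X x))"
      using swap by (intro sum.cong) (auto simp: weights_full)
    ultimately show ?thesis
      unfolding sum_cone sum_cliques using wo by (simp add: \<rho>_def sum_subtractf)
  qed
  show ?case
    unfolding loc loco tot toto using step.IH[OF k inv'] .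
qed

theorem theorem1p4:
  fixes k :: nat and V :: "'a set" and E :: "'a set set" and C :: "'a set"
  assumes "k \<ge> 1"
    and "ktree k V E"
    and "k_clique k V E C"
  shows "mu_at k V E C < 2 * mu k V E"
proof -
  let ?A = "sub_ktrees k V E"
  let ?B = "sub_ktrees_at k V E C"
  have C: "C \<in> cliques k (V, E)"
    using assms(3) by (simp add: cliques_def)
  have fin: "finite ?A"
    by (rule finite_sub_ktrees[OF assms(2)])
  have B: "?B = {S \<in> ?A. C \<in> cliques k S}"
    using assms(3) by (auto simp: sub_ktrees_at_def cliques_def k_clique_altdef)
  have "full C \<in> ?B"
    using full_in_sub_ktrees[OF C] assms(3)
    unfolding B by (simp add: cliques_full k_clique_def)
  moreover have "?B \<subseteq> ?A"
    unfolding B by blast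
  ultimately have pos: "0 < card ?B" "0 < card ?A"
    using fin finite_subset[of ?B ?A] by (auto simp only: card_gt_0_iff)
  \<comment> \<open>Initially nothing hangs below any clique: its only sub-k-tree is itself, of
    order \<open>k\<close>, and the inequalities of \<open>weight_inv\<close> hold with
    equality.\<close>
  have "real k * card ?B
      \<le> 2 * (\<Sum>S\<in>?A. real (card (fst S))) * card ?B - (\<Sum>S\<in>?B. real (card (fst S))) * card ?A"
    using weighted_mean_bound[OF ktree_imp_ktree_from[OF assms(2) C assms(1)] assms(1),
        of "\<lambda>_. 1" "\<lambda>_. 0" "\<lambda>_. 1" "\<lambda>_. real k"] fin
    by (simp add: weight_inv_def clique_weight_def clique_order_def B sum.inter_filter
        flip: sum.inter_filter)
  \<comment> \<open>The additive gain \<open>k\<close> becomes the strictness of the claim.\<close>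
  moreover have "0 < real k * card ?B"
    using assms(1) pos by simp
  ultimately have "(\<Sum>S\<in>?B. real (card (fst S))) * card ?A
      < 2 * (\<Sum>S\<in>?A. real (card (fst S))) * card ?B"
    by linarith
  then show ?thesis
    using pos by (simp add: mu_def mu_at_def avg_order_def case_prod_beta' field_simps)
qed

end
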